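(* Let $P$ be a finite set of data points with a symmetric real-valued dissimilarity on pairs, and let $T$ be the cluster tree produced from $P$ by hierarchical agglomerative clustering with average linkage $d$. If $T$ is stable, then RAC with average linkage, started from the singleton clusters of $P$, completes in a number of rounds equal to the height of $T$.
   Context: Average linkage: for disjoint nonempty $A,B\subseteq P$, $d(A,B)=\frac{1}{|A||B|}\sum_{a\in A,b\in B}d(a,b)$, where $d(a,b)$ is the dissimilarity between points. Hierarchical agglomerative clustering (HAC) starts with all points in singleton clusters and repeatedly merges the two distinct clusters minimizing $d$, until one cluster remains. The cluster tree is the binary tree whose nodes are the clusters occurring in this process (each identified with its set of leaves/points), the leaves being the singletons, and the children of a merged cluster $A\cup B$ being $A$ and $B$. Its height is the maximum number of edges on a root-to-leaf path. Stability: a cluster tree $T$ is stable if for any non-overlapping nodes $X,Y\in T$ (i.e. the leaf sets of $X$ and $Y$ are disjoint), any nonempty proper subset $A\subset X$ and any nonempty $B\subseteq Y$, one has $d(A,X\setminus A)<d(A,B)$. Reciprocal nearest neighbors: in a set of clusters $\mathcal{C}$, distinct $A,B\in\mathcal{C}$ are reciprocal nearest neighbors if there is no other $C\in\mathcal{C}$ with $d(A,C)<d(A,B)$ or $d(B,C)<d(A,B)$. RAC (Reciprocal Agglomerative Clustering) starts with each point in its own singleton cluster and proceeds in rounds; in each round, all pairs of reciprocal nearest neighbors in the current set of clusters are simultaneously merged; it stops when one cluster remains. *)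

theory Defs
  imports Complex_Main
begin

definition average_linkage :: "('a \<Rightarrow> 'a \<Rightarrow> real) \<Rightarrow> 'a set \<Rightarrow> 'a set \<Rightarrow> real" where
  "average_linkage d A B = (\<Sum>a\<in>A. \<Sum>b\<in>B. d a b) / (real (card A) * real (card B))"

datatype 'a cluster_tree = Leaf 'a | Merge "'a cluster_tree" "'a cluster_tree"

fun leaves :: "'a cluster_tree \<Rightarrow> 'a set" where
  "leaves (Leaf x) = {x}"
| "leaves (Merge l r) = leaves l \<union> leaves r"

(* A node is identified with the set of points below it. *)
fun nodes :: "'a cluster_tree \<Rightarrow> 'a set set" where
  "nodes (Leaf x) = {{x}}"
| "nodes (Merge l r) = insert (leaves l \<union> leaves r) (nodes l \<union> nodes r)"

fun height :: "'a cluster_tree \<Rightarrow> nat" where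
  "height (Leaf x) = 0"
| "height (Merge l r) = Suc (max (height l) (height r))"

(* A state is a forest: each current cluster is carried along with the tree of merges that
   produced it. Any minimizing pair may be merged, so ties are broken arbitrarily. *)
inductive hac_step ::
  "('a \<Rightarrow> 'a \<Rightarrow> real) \<Rightarrow> 'a cluster_tree set \<Rightarrow> 'a cluster_tree set \<Rightarrow> bool"
  for d where
  "\<lbrakk>S \<in> F; U \<in> F; S \<noteq> U;
    \<And>S' U'. \<lbrakk>S' \<in> F; U' \<in> F; S' \<noteq> U'\<rbrakk>
      \<Longrightarrow> average_linkage d (leaves S) (leaves U) \<le> average_linkage d (leaves S') (leaves U')\<rbrakk>
   \<Longrightarrow> hac_step d F (insert (Merge S U) (F - {S, U}))"

definition hac_tree :: "('a \<Rightarrow> 'a \<Rightarrow> real) \<Rightarrow> 'a set \<Rightarrow> 'a cluster_tree \<Rightarrow> bool" where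
  "hac_tree d P T \<longleftrightarrow> (hac_step d)\<^sup>*\<^sup>* (Leaf ` P) {T}"

definition stable_tree :: "('a \<Rightarrow> 'a \<Rightarrow> real) \<Rightarrow> 'a cluster_tree \<Rightarrow> bool" where
  "stable_tree d T \<longleftrightarrow>
    (\<forall>X\<in>nodes T. \<forall>Y\<in>nodes T. X \<inter> Y = {} \<longrightarrow>
      (\<forall>A B. A \<noteq> {} \<and> A \<subset> X \<and> B \<noteq> {} \<and> B \<subseteq> Y \<longrightarrow>
        average_linkage d A (X - A) < average_linkage d A B))"

definition reciprocal_nn ::
  "('a \<Rightarrow> 'a \<Rightarrow> real) \<Rightarrow> 'a set set \<Rightarrow> 'a set \<Rightarrow> 'a set \<Rightarrow> bool" where
  "reciprocal_nn d \<C> A B \<longleftrightarrow> A \<in> \<C> \<and> B \<in> \<C> \<and> A \<noteq> B \<and>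
    \<not> (\<exists>C\<in>\<C> - {A, B}. average_linkage d A C < average_linkage d A B \<or>
                      average_linkage d B C < average_linkage d A B)"

(* Merging all reciprocal pairs at once only makes sense if these pairs are disjoint, which
   can fail when there are ties. No convention is adopted for that case: the round is then
   undefined, and no run of RAC passes through such a state. *)
definition rac_round :: "('a \<Rightarrow> 'a \<Rightarrow> real) \<Rightarrow> 'a set set \<Rightarrow> 'a set set \<Rightarrow> bool" where
  "rac_round d \<C> \<C>' \<longleftrightarrow>
    (\<forall>A B B'. reciprocal_nn d \<C> A B \<and> reciprocal_nn d \<C> A B' \<longrightarrow> B = B') \<and>
    \<C>' = {A \<union> B | A B. reciprocal_nn d \<C> A B} \<union> {A \<in> \<C>. \<nexists>B. reciprocal_nn d \<C> A B}"

inductive rac_completes_in :: "('a \<Rightarrow> 'a \<Rightarrow> real) \<Rightarrow> 'a set set \<Rightarrow> nat \<Rightarrow> bool" for d where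
  stop: "card \<C> = 1 \<Longrightarrow> rac_completes_in d \<C> 0"
| round: "\<lbrakk>card \<C> \<noteq> 1; rac_round d \<C> \<C>'; rac_completes_in d \<C>' n\<rbrakk>
    \<Longrightarrow> rac_completes_in d \<C> (Suc n)"

lemma rac_completes_in_unique:
  assumes "rac_completes_in d \<C> m" and "rac_completes_in d \<C> n"
  shows "m = n"
  using assms
proof (induction arbitrary: n rule: rac_completes_in.induct)
  case (stop \<C>)
  then show ?case by (auto elim: rac_completes_in.cases)
next
  case (round \<C> \<C>' m)
  from round.prems show ?case
  proof cases
    case stop
    with round.hyps show ?thesis by simp
  next
    case (round \<C>'' k)
    have "\<C>'' = \<C>'"
      using \<open>rac_round d \<C> \<C>''\<close> \<open>rac_round d \<C> \<C>'\<close> by (simp add: rac_round_def)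
    with round \<open>\<And>n. rac_completes_in d \<C>' n \<Longrightarrow> m = n\<close> show ?thesis by simp
  qed
qed

end

(* After n rounds, the clusters of RAC are the maximal nodes of T of height at most n.
   Stability forces two such clusters to be reciprocal nearest neighbors exactly when they are
   siblings: if B lies outside the parent of A, then the sibling of A is strictly closer to A
   than B on average, hence so is one of the clusters that make up this sibling. *)
theory Submission
  imports Defs
begin

section \<open>Subtrees, siblings and cuts of a tree by height\<close>

fun subtrees :: "'a cluster_tree \<Rightarrow> 'a cluster_tree set" where
  "subtrees (Leaf x) = {Leaf x}"
| "subtrees (Merge l r) = insert (Merge l r) (subtrees l \<union> subtrees r)"

text \<open>The datatype lets the two children of a node share points; trees built by HAC never
  do.\<close>

fun disjoint_merges :: "'a cluster_tree \<Rightarrow> bool" where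
  "disjoint_merges (Leaf x) \<longleftrightarrow> True"
| "disjoint_merges (Merge l r) \<longleftrightarrow>
    disjoint_merges l \<and> disjoint_merges r \<and> leaves l \<inter> leaves r = {}"

text \<open>Descending from the root, the recursion stops at the first nodes of height at most
  \<open>n\<close>, so it collects the maximal such nodes. A leaf has height 0 and needs no
  test.\<close>

fun height_cut :: "nat \<Rightarrow> 'a cluster_tree \<Rightarrow> 'a set set" where
  "height_cut n (Leaf x) = {{x}}"
| "height_cut n (Merge l r) =
    (if height (Merge l r) \<le> n then {leaves l \<union> leaves r} else height_cut n l \<union> height_cut n r)"

definition siblings :: "'a cluster_tree \<Rightarrow> 'a cluster_tree \<Rightarrow> 'a cluster_tree \<Rightarrow> bool" where
  "siblings t s s' \<longleftrightarrow> Merge s s' \<in> subtrees t \<or> Merge s' s \<in> subtrees t"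

text \<open>The parent of such a pair has height \<open>Suc n\<close>, so these pairs are the ones
  due to merge between \<open>height_cut n t\<close> and \<open>height_cut (Suc n) t\<close>.
  Relating leaf sets instead of trees allows a direct comparison with
  \<open>reciprocal_nn\<close>.\<close>

definition merging :: "nat \<Rightarrow> 'a cluster_tree \<Rightarrow> 'a set \<Rightarrow> 'a set \<Rightarrow> bool" where
  "merging n t A B \<longleftrightarrow>
    (\<exists>s s'. siblings t s s' \<and> max (height s) (height s') = n \<and> A = leaves s \<and> B = leaves s')"

lemma leaves_nonempty [simp]: "leaves t \<noteq> {}"
  by (induction t) auto

lemma finite_leaves [simp]: "finite (leaves t)"
  by (induction t) auto

lemma subtrees_refl [simp]: "t \<in> subtrees t"
  by (cases t) auto

lemma subtrees_trans: "s \<in> subtrees t \<Longrightarrow> u \<in> subtrees s \<Longrightarrow> u \<in> subtrees t"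
  by (induction t) auto

lemma leaves_subtree: "s \<in> subtrees t \<Longrightarrow> leaves s \<subseteq> leaves t"
  by (induction t) auto

lemma height_subtree: "s \<in> subtrees t \<Longrightarrow> height s \<le> height t"
  by (induction t) fastforce+

lemma disjoint_merges_subtree:
  "disjoint_merges t \<Longrightarrow> s \<in> subtrees t \<Longrightarrow> disjoint_merges s"
  by (induction t) auto

lemma nodes_eq_leaves_subtrees: "nodes t = leaves ` subtrees t"
  by (induction t) auto

lemma siblings_sym: "siblings t s s' \<Longrightarrow> siblings t s' s"
  by (auto simp: siblings_def)

lemma siblings_subtree: "s \<in> subtrees t \<Longrightarrow> siblings s u u' \<Longrightarrow> siblings t u u'"
  by (auto simp: siblings_def intro: subtrees_trans)

lemma subtrees_of_siblings:
  assumes "siblings t s s'"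
  shows "s \<in> subtrees t" "s' \<in> subtrees t"
  using assms by (auto simp: siblings_def intro: subtrees_trans)

lemma parent_node: "siblings t s s' \<Longrightarrow> leaves s \<union> leaves s' \<in> nodes t"
  unfolding siblings_def nodes_eq_leaves_subtrees
  by (metis image_eqI leaves.simps(2) sup_commute)

lemma siblings_disjoint:
  "disjoint_merges t \<Longrightarrow> siblings t s s' \<Longrightarrow> leaves s \<inter> leaves s' = {}"
  using disjoint_merges_subtree by (fastforce simp: siblings_def)

lemma merging_sym: "merging n t A B \<Longrightarrow> merging n t B A"
  unfolding merging_def by (metis siblings_sym max.commute)

lemma merging_leaves:
  "merging n t A B \<Longrightarrow> A \<subseteq> leaves t \<and> B \<subseteq> leaves t"
  by (auto simp: merging_def dest: subtrees_of_siblings leaves_subtree)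

lemma merging_height: "merging n t A B \<Longrightarrow> n < height t"
  by (auto simp: merging_def siblings_def dest!: height_subtree)

lemma merging_Merge:
  "merging n (Merge l r) A B \<longleftrightarrow>
    max (height l) (height r) = n \<and>
      (A = leaves l \<and> B = leaves r \<or> A = leaves r \<and> B = leaves l) \<or>
    merging n l A B \<or> merging n r A B"
proof -
  have *: "siblings (Merge l r) s s' \<longleftrightarrow>
      s = l \<and> s' = r \<or> s = r \<and> s' = l \<or> siblings l s s' \<or> siblings r s s'" for s s'
    by (auto simp: siblings_def)
  \<comment> \<open>An abstract \<open>Q\<close> separates the case split on siblings from the
    conditions on heights and leaf sets.\<close>
  have ex: "(\<exists>s s'. siblings (Merge l r) s s' \<and> Q s s') \<longleftrightarrow>
      Q l r \<or> Q r l \<or> (\<exists>s s'. siblings l s s' \<and> Q s s') \<or> (\<exists>s s'. siblings r s s' \<and> Q s s')" for Q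
    unfolding * by blast
  show ?thesis
    unfolding merging_def ex max.commute[of "height r" "height l"] by argo
qed

section \<open>Height cuts as partitions of the leaf set\<close>

lemma cut_whole: "height t \<le> n \<Longrightarrow> height_cut n t = {leaves t}"
  by (cases t) auto

lemma cut_0: "height_cut 0 t = (\<lambda>x. {x}) ` leaves t"
  by (induction t) auto

lemma Union_cut: "\<Union> (height_cut n t) = leaves t"
  by (induction t) auto

lemma cut_subset_nodes: "height_cut n t \<subseteq> nodes t"
  by (induction t) auto

lemma cut_member_subset: "A \<in> height_cut n t \<Longrightarrow> A \<subseteq> leaves t"
  using Union_cut by fastforce

lemma finite_cut [simp]: "finite (height_cut n t)"
  by (induction t) auto

lemma cut_nonempty [simp]: "height_cut n t \<noteq> {}"
  by (induction t) auto

lemma cut_member_nonempty: "A \<in> height_cut n t \<Longrightarrow> A \<noteq> {}"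
  by (induction t) (auto split: if_splits)

lemma cut_disjoint:
  "disjoint_merges t \<Longrightarrow> A \<in> height_cut n t \<Longrightarrow> B \<in> height_cut n t \<Longrightarrow> A \<noteq> B \<Longrightarrow> A \<inter> B = {}"
proof (induction t)
  case (Merge l r)
  have "A \<inter> B = {}" if "A \<in> height_cut n l" "B \<in> height_cut n r" for A B
    using cut_member_subset[OF that(1)] cut_member_subset[OF that(2)] Merge.prems(1) by auto
  with Merge show ?case
    by (fastforce split: if_splits)
qed auto

text \<open>All ancestors of a node higher than \<open>n\<close> are higher than \<open>n\<close>
  too, so the recursion in \<open>height_cut\<close> reaches that node.\<close>

lemma cut_subtree: "s \<in> subtrees t \<Longrightarrow> n < height s \<Longrightarrow> height_cut n s \<subseteq> height_cut n t"
proof (induction t)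
  case (Merge l r)
  then show ?case
    using height_subtree[of s "Merge l r"] by auto
qed auto

text \<open>The bound says that the parent is higher than \<open>n\<close>; the cut of the parent
  then consists of the cuts of its two children.\<close>

lemma cut_siblings:
  assumes "siblings t s s'" "n \<le> max (height s) (height s')"
  shows "height_cut n s \<subseteq> height_cut n t" "height_cut n s' \<subseteq> height_cut n t"
  using assms cut_subtree[of "Merge s s'" t n] cut_subtree[of "Merge s' s" t n]
  by (auto simp: siblings_def less_Suc_eq_le max.commute)

text \<open>The recursion does not stop at the root, so the node where it stops has a parent, which
  is higher than \<open>n\<close>; the lower bound on the maximum expresses this.\<close>

lemma cut_has_sibling:
  assumes "A \<in> height_cut n t" "n < height t"
  obtains s s' where "siblings t s s'" "n \<le> max (height s) (height s')" "height s \<le> n"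
    "A = leaves s"
  using assms
proof (induction t arbitrary: thesis)
  case (Merge l r)
  show ?case
  proof (cases "A \<in> height_cut n l")
    case True
    show ?thesis
    proof (cases "n < height l")
      case True
      from Merge.IH(1)[OF _ \<open>A \<in> height_cut n l\<close> True] obtain s s' where
        "siblings l s s'" "n \<le> max (height s) (height s')" "height s \<le> n" "A = leaves s"
        by blast
      then show ?thesis
        using Merge.prems(1) siblings_subtree[of l "Merge l r"] by auto
    next
      \<comment> \<open>The cut of \<open>l\<close> is now \<open>l\<close> alone, so the sibling
        sought is \<open>r\<close>.\<close>
      case False
      with True show ?thesis
        using Merge.prems(1)[of l r] Merge.prems(3) by (auto simp: cut_whole siblings_def)
    qed
  next
    case False
    with Merge.prems have A: "A \<in> height_cut n r" by auto
    show ?thesis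
    proof (cases "n < height r")
      case True
      from Merge.IH(2)[OF _ A True] obtain s s' where
        "siblings r s s'" "n \<le> max (height s) (height s')" "height s \<le> n" "A = leaves s"
        by blast
      then show ?thesis
        using Merge.prems(1) siblings_subtree[of r "Merge l r"] by auto
    next
      case False
      with A show ?thesis
        using Merge.prems(1)[of r l] Merge.prems(3) by (auto simp: cut_whole siblings_def)
    qed
  qed
qed auto

text \<open>A single cluster would have to be the cut of both children, which have disjoint nonempty
  leaf sets. This keeps RAC from stopping early.\<close>

lemma cut_card:
  assumes "disjoint_merges t" "n < height t"
  shows "card (height_cut n t) \<noteq> 1"
proof
  assume "card (height_cut n t) = 1"
  then obtain X where X: "height_cut n t = {X}"
    by (auto simp: card_1_singleton_iff)
  obtain l r where t: "t = Merge l r"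
    using assms by (cases t) auto
  have "height_cut n l = {X}" "height_cut n r = {X}"
    using X assms t cut_nonempty[of n l] cut_nonempty[of n r] by (auto simp: Un_singleton_iff)
  then show False
    using Union_cut[of n l] Union_cut[of n r] assms t leaves_nonempty[of l] by auto
qed

text \<open>The right-hand side has the shape of the one in \<open>rac_round_def\<close>, with
  \<open>merging\<close> in place of \<open>reciprocal_nn\<close>. The cases are: the root already
  formed, formed in this round, or formed later.\<close>

lemma cut_Suc:
  assumes "disjoint_merges t"
  shows "height_cut (Suc n) t =
    {A \<union> B | A B. merging n t A B} \<union> {A \<in> height_cut n t. \<nexists>B. merging n t A B}"
  using assms
proof (induction t)
  case (Leaf x)
  then show ?case
    by (auto simp: merging_def siblings_def)
next
  case (Merge l r)
  consider "height (Merge l r) \<le> n" | "height (Merge l r) = Suc n"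
    | "height (Merge l r) > Suc n" by linarith
  then show ?case
  proof cases
    case 1
    then have "\<not> merging n (Merge l r) A B" for A B
      using merging_height by fastforce
    with 1 show ?thesis by auto
  next
    case 2
    then have h: "height l \<le> n" "height r \<le> n" "max (height l) (height r) = n"
      by auto
    have no: "\<not> merging n l A B" "\<not> merging n r A B" for A B
      using h merging_height by fastforce+
    have m: "merging n (Merge l r) A B \<longleftrightarrow>
        A = leaves l \<and> B = leaves r \<or> A = leaves r \<and> B = leaves l" for A B
      using no h unfolding merging_Merge by blast
    show ?thesis
      unfolding m using 2 h by (auto simp: cut_whole)
  next
    case 3
    then have m: "merging n (Merge l r) A B \<longleftrightarrow> merging n l A B \<or> merging n r A B" for A B
      unfolding merging_Merge by auto
    have lr: "leaves l \<inter> leaves r = {}"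
      using Merge.prems by simp
    \<comment> \<open>For the clusters left alone, a cluster below one child must not count as
      merged because of a pair below the other child.\<close>
    have "\<not> merging n r A B" if "A \<in> height_cut n l" for A B
      using that cut_member_subset[of A n l] cut_member_nonempty[of A n l]
        merging_leaves[of n r A B] lr by blast
    moreover have "\<not> merging n l A B" if "A \<in> height_cut n r" for A B
      using that cut_member_subset[of A n r] cut_member_nonempty[of A n r]
        merging_leaves[of n l A B] lr by blast
    moreover have "height_cut (Suc n) (Merge l r) = height_cut (Suc n) l \<union> height_cut (Suc n) r"
      "height_cut n (Merge l r) = height_cut n l \<union> height_cut n r"
      using 3 by auto
    ultimately show ?thesis
      using Merge unfolding m by auto
  qed
qed

section \<open>Average linkage: symmetry and disjoint unions\<close>

lemma average_linkage_sym:
  assumes "\<And>a b. a \<in> A \<Longrightarrow> b \<in> B \<Longrightarrow> d a b = d b a"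
  shows "average_linkage d A B = average_linkage d B A"
proof -
  have "(\<Sum>a\<in>A. \<Sum>b\<in>B. d a b) = (\<Sum>a\<in>A. \<Sum>b\<in>B. d b a)"
    using assms by (auto intro!: sum.cong)
  then show ?thesis
    unfolding average_linkage_def by (simp add: sum.swap[of _ B A] mult.commute)
qed

text \<open>The linkage to a disjoint union is the mean of the linkages to its parts, weighted by
  their cardinalities, so a lower bound for all parts passes to the union.\<close>

lemma average_linkage_Union_ge:
  assumes "finite A" "A \<noteq> {}" "finite \<C>" "\<C> \<noteq> {}"
    and sets: "\<And>C. C \<in> \<C> \<Longrightarrow> finite C \<and> C \<noteq> {}"
    and disj: "\<And>C D. C \<in> \<C> \<Longrightarrow> D \<in> \<C> \<Longrightarrow> C \<noteq> D \<Longrightarrow> C \<inter> D = {}"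
    and ge: "\<And>C. C \<in> \<C> \<Longrightarrow> m \<le> average_linkage d A C"
  shows "m \<le> average_linkage d A (\<Union>\<C>)"
proof -
  have "finite (\<Union>\<C>)" "\<Union>\<C> \<noteq> {}"
    using assms(3,4) sets by auto
  then have pos: "0 < real (card A) * real (card (\<Union>\<C>))"
    using assms(1,2) by (simp add: card_gt_0_iff)
  \<comment> \<open>Denominators are cleared so that the bounds can be added over the parts.\<close>
  have part: "m * (real (card A) * real (card C)) \<le> (\<Sum>a\<in>A. \<Sum>b\<in>C. d a b)" if "C \<in> \<C>" for C
  proof -
    have "0 < real (card A) * real (card C)"
      using assms(1,2) sets[OF that] by (simp add: card_gt_0_iff)
    with ge[OF that] show ?thesis
      by (simp add: average_linkage_def pos_le_divide_eq)
  qed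
  have "card (\<Union>\<C>) = (\<Sum>C\<in>\<C>. card C)"
    using sets disj by (intro card_Union_disjoint) (auto simp: pairwise_def disjnt_def)
  then have "m * (real (card A) * real (card (\<Union>\<C>))) = (\<Sum>C\<in>\<C>. m * (real (card A) * real (card C)))"
    by (simp add: sum_distrib_left)
  also have "\<dots> \<le> (\<Sum>C\<in>\<C>. \<Sum>a\<in>A. \<Sum>b\<in>C. d a b)"
    using part by (rule sum_mono)
  also have "\<dots> = (\<Sum>a\<in>A. \<Sum>C\<in>\<C>. \<Sum>b\<in>C. d a b)"
    by (rule sum.swap)
  also have "\<dots> = (\<Sum>a\<in>A. \<Sum>b\<in>\<Union>\<C>. d a b)"
    using sets disj by (subst sum.Union_disjoint) auto
  finally show ?thesis
    using pos by (simp add: average_linkage_def pos_le_divide_eq)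
qed

section \<open>Nearest neighbors in a stable tree\<close>

text \<open>This is stability with the parent as \<open>X\<close> and \<open>leaves s\<close> as its
  proper subset, whose complement in \<open>X\<close> is \<open>leaves s'\<close>; the other node is
  taken whole.\<close>

lemma sibling_closer:
  assumes "disjoint_merges t" "stable_tree d t" "siblings t s s'"
    and "B \<in> nodes t" "B \<inter> (leaves s \<union> leaves s') = {}"
  shows "average_linkage d (leaves s) (leaves s') < average_linkage d (leaves s) B"
proof -
  have disj: "leaves s \<inter> leaves s' = {}"
    using siblings_disjoint assms by blast
  then have "leaves s \<subset> leaves s \<union> leaves s'" "(leaves s \<union> leaves s') - leaves s = leaves s'"
    using leaves_nonempty[of s'] by blast+
  moreover have "B \<noteq> {}"
    using assms(4) by (auto simp: nodes_eq_leaves_subtrees)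
  ultimately show ?thesis
    using assms(2) parent_node[OF assms(3)] assms(4,5) unfolding stable_tree_def
    by (metis Int_commute leaves_nonempty order_refl)
qed

text \<open>The sibling \<open>s'\<close> may be higher than \<open>n\<close> and so not a cluster
  of the cut. If \<open>B\<close> missed the parent, every cluster inside \<open>s'\<close> would be
  at least as far from \<open>s\<close> as \<open>B\<close>, hence on average so would
  \<open>s'\<close>, against \<open>sibling_closer\<close>.\<close>

lemma reciprocal_nn_meets_parent:
  assumes "disjoint_merges t" "stable_tree d t" "siblings t s s'"
    and "n \<le> max (height s) (height s')"
    and rnn: "reciprocal_nn d (height_cut n t) (leaves s) B"
  shows "B \<inter> (leaves s \<union> leaves s') \<noteq> {}"
proof
  assume disj: "B \<inter> (leaves s \<union> leaves s') = {}"
  have B: "B \<in> height_cut n t"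
    using rnn by (simp add: reciprocal_nn_def)
  have sub: "height_cut n s' \<subseteq> height_cut n t"
    using cut_siblings assms by blast
  \<comment> \<open>Reciprocity compares \<open>B\<close> only with clusters other than the pair
    itself, so \<open>C\<close> must first be told apart from both.\<close>
  have far: "average_linkage d (leaves s) B \<le> average_linkage d (leaves s) C" if "C \<in> height_cut n s'" for C
  proof -
    have "C \<subseteq> leaves s'" "C \<noteq> {}"
      using that cut_member_subset cut_member_nonempty by blast+
    then have "C \<noteq> leaves s" "C \<noteq> B"
      using disj siblings_disjoint[OF assms(1,3)] by blast+
    then show ?thesis
      using rnn sub that by (force simp: reciprocal_nn_def)
  qed
  have "average_linkage d (leaves s) B \<le> average_linkage d (leaves s) (\<Union> (height_cut n s'))"
  proof (rule average_linkage_Union_ge)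
    show "finite C \<and> C \<noteq> {}" if "C \<in> height_cut n s'" for C
      using cut_member_subset[OF that] cut_member_nonempty[OF that]
      by (simp add: finite_subset[OF _ finite_leaves])
    show "C \<inter> D = {}" if "C \<in> height_cut n s'" "D \<in> height_cut n s'" "C \<noteq> D" for C D
      using cut_disjoint[OF assms(1) _ _ that(3)] that(1,2) sub by auto
  qed (use far in auto)
  moreover have "B \<in> nodes t"
    using B cut_subset_nodes by blast
  ultimately show False
    using sibling_closer[OF assms(1-3) _ disj] by (simp add: Union_cut)
qed

lemma reciprocal_nn_sym:
  assumes "\<And>a b. a \<in> \<Union>\<C> \<Longrightarrow> b \<in> \<Union>\<C> \<Longrightarrow> d a b = d b a"
    and "reciprocal_nn d \<C> A B"
  shows "reciprocal_nn d \<C> B A"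
proof -
  have "average_linkage d A B = average_linkage d B A"
    using assms by (intro average_linkage_sym) (auto simp: reciprocal_nn_def)
  then show ?thesis
    using assms(2) by (auto simp: reciprocal_nn_def insert_commute)
qed

text \<open>Any other cluster of the cut is disjoint from both siblings, hence from their parent.
  The strict inequality later rules out a second partner for \<open>A\<close>.\<close>

lemma merging_closer:
  assumes "disjoint_merges t" "stable_tree d t" "merging n t A B" "C \<in> height_cut n t - {A, B}"
  shows "average_linkage d A B < average_linkage d A C"
proof -
  obtain s s' where s: "siblings t s s'" "max (height s) (height s') = n"
    "A = leaves s" "B = leaves s'"
    using assms(3) by (auto simp: merging_def)
  then have "A \<in> height_cut n t" "B \<in> height_cut n t"
    using cut_siblings[of t s s' n] cut_whole[of s n] cut_whole[of s' n] by auto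
  then have "C \<inter> A = {}" "C \<inter> B = {}"
    using cut_disjoint[OF assms(1)] assms(4) by blast+
  then show ?thesis
    using sibling_closer[OF assms(1,2) s(1), of C] assms(4) s cut_subset_nodes by blast
qed

lemma reciprocal_nn_cut_iff:
  assumes "disjoint_merges t" "stable_tree d t" "n < height t"
    and sym: "\<And>a b. a \<in> leaves t \<Longrightarrow> b \<in> leaves t \<Longrightarrow> d a b = d b a"
  shows "reciprocal_nn d (height_cut n t) A B \<longleftrightarrow> merging n t A B"
proof
  assume m: "merging n t A B"
  then obtain s s' where s: "siblings t s s'" "max (height s) (height s') = n"
    "A = leaves s" "B = leaves s'"
    by (auto simp: merging_def)
  then have "A \<in> height_cut n t" "B \<in> height_cut n t"
    using cut_siblings[of t s s' n] cut_whole[of s n] cut_whole[of s' n] by auto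
  moreover have "A \<noteq> B"
    using siblings_disjoint[OF assms(1) s(1)] s by auto
  moreover have "average_linkage d A B = average_linkage d B A"
    using merging_leaves[OF m] sym by (intro average_linkage_sym) blast
  ultimately show "reciprocal_nn d (height_cut n t) A B"
    using merging_closer[OF assms(1,2) m] merging_closer[OF assms(1,2) merging_sym[OF m]]
    by (fastforce simp: reciprocal_nn_def insert_commute)
next
  assume rnn: "reciprocal_nn d (height_cut n t) A B"
  then have AB: "A \<in> height_cut n t" "B \<in> height_cut n t" "A \<noteq> B"
    by (auto simp: reciprocal_nn_def)
  have rnn': "reciprocal_nn d (height_cut n t) B A"
    by (rule reciprocal_nn_sym[OF _ rnn]) (simp add: sym Union_cut)
  obtain s s' where s: "siblings t s s'" "n \<le> max (height s) (height s')" "height s \<le> n"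
    "A = leaves s"
    by (rule cut_has_sibling[OF AB(1) assms(3)])
  have "B \<inter> (leaves s \<union> leaves s') \<noteq> {}"
    using reciprocal_nn_meets_parent[OF assms(1,2) s(1,2)] rnn s(4) by simp
  \<comment> \<open>\<open>B\<close> meets the parent but is disjoint from \<open>A\<close>, so it
    meets \<open>s'\<close>; being a block of the partition, it is one of the clusters inside
    \<open>s'\<close>.\<close>
  then have "B \<inter> \<Union> (height_cut n s') \<noteq> {}"
    using cut_disjoint[OF assms(1) AB] s(4) Union_cut[of n s'] by blast
  then have B: "B \<in> height_cut n s'"
    using cut_disjoint[OF assms(1) AB(2)] cut_siblings(2)[OF s(1,2)] by blast
  \<comment> \<open>Otherwise \<open>B\<close> has its own parent inside \<open>s'\<close>. With the
    roles exchanged, \<open>A\<close> would have to meet that parent, yet \<open>A\<close> is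
    disjoint from \<open>s'\<close>.\<close>
  have "height s' \<le> n"
  proof (rule ccontr)
    assume "\<not> height s' \<le> n"
    then have "n < height s'" by simp
    then obtain u u' where u: "siblings s' u u'" "n \<le> max (height u) (height u')" "B = leaves u"
      by (rule cut_has_sibling[OF B])
    have "leaves u \<union> leaves u' \<subseteq> leaves s'"
      using u(1) by (auto dest: subtrees_of_siblings leaves_subtree)
    moreover have "A \<inter> leaves s' = {}"
      using siblings_disjoint[OF assms(1) s(1)] s(4) by simp
    moreover have "siblings t u u'"
      using u(1) s(1) by (meson siblings_subtree subtrees_of_siblings(2))
    ultimately show False
      using reciprocal_nn_meets_parent[OF assms(1,2) _ u(2)] rnn' u(3) by blast
  qed
  then have "B = leaves s'" "max (height s) (height s') = n"
    using s B by (auto simp: cut_whole)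
  then show "merging n t A B"
    using s unfolding merging_def by blast
qed

section \<open>Rounds of RAC as successive height cuts\<close>

lemma rac_round_cut:
  assumes "disjoint_merges t" "stable_tree d t" "n < height t"
    and "\<And>a b. a \<in> leaves t \<Longrightarrow> b \<in> leaves t \<Longrightarrow> d a b = d b a"
  shows "rac_round d (height_cut n t) (height_cut (Suc n) t)"
proof -
  note iff = reciprocal_nn_cut_iff[OF assms]
  \<comment> \<open>A round is defined only if partners are unique. Of two distinct partners of
    \<open>A\<close>, each would be strictly closer to \<open>A\<close> than the other.\<close>
  have "B = B'" if "merging n t A B" "merging n t A B'" for A B B'
  proof (rule ccontr)
    assume "B \<noteq> B'"
    have rnn: "reciprocal_nn d (height_cut n t) A B" "reciprocal_nn d (height_cut n t) A B'"
      using that iff by simp_all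
    then have "B \<in> height_cut n t - {A, B'}" "B' \<in> height_cut n t - {A, B}"
      using \<open>B \<noteq> B'\<close> by (auto simp: reciprocal_nn_def)
    then show False
      using merging_closer[OF assms(1,2)] that by (meson less_asym)
  qed
  then show ?thesis
    unfolding rac_round_def cut_Suc[OF assms(1)] by (auto simp: iff)
qed

text \<open>Induction on the number \<open>k\<close> of rounds still to come, with the level
  \<open>n\<close> moving up as \<open>k\<close> goes down; at \<open>k = 0\<close> only the root
  remains.\<close>

lemma rac_completes_in_cut:
  assumes "disjoint_merges t" "stable_tree d t"
    and "\<And>a b. a \<in> leaves t \<Longrightarrow> b \<in> leaves t \<Longrightarrow> d a b = d b a"
    and "n + k = height t"
  shows "rac_completes_in d (height_cut n t) k"
  using assms(4)
proof (induction k arbitrary: n)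
  case 0
  then show ?case
    by (intro rac_completes_in.stop) (simp add: cut_whole)
next
  case (Suc k)
  then have "n < height t" and "rac_completes_in d (height_cut (Suc n) t) k"
    by simp_all
  moreover from this have "rac_round d (height_cut n t) (height_cut (Suc n) t)"
    using assms(1-3) by (intro rac_round_cut)
  ultimately show ?case
    using assms(1) by (intro rac_completes_in.round cut_card)
qed

section \<open>Trees produced by HAC\<close>

text \<open>Disjointness between the trees of the forest is what makes each new merge disjoint, so
  it is carried along in the induction.\<close>

lemma hac_forest_invariant:
  assumes "(hac_step d)\<^sup>*\<^sup>* (Leaf ` P) F"
  shows "(\<forall>t\<in>F. disjoint_merges t) \<and> pairwise (\<lambda>s t. leaves s \<inter> leaves t = {}) F \<and>
    \<Union> (leaves ` F) = P"
  using assms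
proof (induction rule: rtranclp_induct)
  case base
  show ?case by (auto simp: pairwise_def)
next
  case (step F F')
  from step.hyps(2) show ?case
  proof cases
    case (1 S U)
    have "disjoint_merges t" if "t \<in> F'" for t
      using that 1 step.IH by (auto simp: pairwise_def)
    moreover have "pairwise (\<lambda>s t. leaves s \<inter> leaves t = {}) F'"
      using 1(1-4) step.IH unfolding pairwise_def by auto
    moreover have "\<Union> (leaves ` F') = P"
      using 1(1-4) step.IH by auto
    ultimately show ?thesis by blast
  qed
qed

theorem theorem5:
  fixes P :: "'a set" and d :: "'a \<Rightarrow> 'a \<Rightarrow> real" and T :: "'a cluster_tree"
  assumes "finite P" and "P \<noteq> {}"
    and "\<And>a b. a \<in> P \<Longrightarrow> b \<in> P \<Longrightarrow> d a b = d b a"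
    and "hac_tree d P T"
    and "stable_tree d T"
  shows "rac_completes_in d ((\<lambda>x. {x}) ` P) (height T)"
proof -
  have "disjoint_merges T" "leaves T = P"
    using hac_forest_invariant[of d P "{T}"] assms(4) by (auto simp: hac_tree_def)
  then show ?thesis
    \<comment> \<open>The cut at level 0 consists of the singletons, where RAC starts, so all
      \<open>height T\<close> rounds remain.\<close>
    using rac_completes_in_cut[of T d 0] assms(3,5) by (simp add: cut_0)
qed

end
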